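(* Consider a Hopfield network $C\dot v = TV - R^{-1}v + I$, $V_i=g_i(v_i)$ ($i=1,\dots,n$), with data as in the context. Then in the coordinates $V=(g_1(v_1),\dots,g_n(v_n))^\top$, ranging over the product of the images of the $g_i$, the network is the gradient system $$\frac{\partial^2 H^*}{\partial V^\top\partial V}(V)\,\dot V = -\frac{\partial P}{\partial V}(V,I),\qquad -V=\frac{\partial P}{\partial I}(V,I),$$ with potential function $P$ and Riemannian metric given by the positive definite matrix $$\frac{\partial^2 H^*}{\partial V^\top\partial V}(V) = \left(\frac{\partial^2 H}{\partial q^\top\partial q}(q)\right)^{-1},\qquad V=\frac{\partial H}{\partial q}(q),\quad q = Cv.$$ Furthermore, for every differentiable input function $I(\cdot)$, along solutions one has the dissipation inequality $$\frac{d}{dt}P(V,I) = -\dot V^\top \frac{\partial^2 H^*}{\partial V^\top\partial V}(V)\,\dot V - V^\top\dot I \;\le\; -V^\top \dot I .$$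
   Context: Hopfield network data: $C=\mathrm{diag}(C_1,\dots,C_n)$ and $R=\mathrm{diag}(R_1,\dots,R_n)$ with $C_i,R_i>0$; $T\in\mathbb{R}^{n\times n}$ is symmetric (not necessarily definite); $I\in\mathbb{R}^n$ is the vector of external currents (possibly time-varying); each $g_i:\mathbb{R}\to\mathbb{R}$ is a smooth function of sigmoid type (bounded) with $g_i'>0$. Put $q_i := C_iv_i$ and $h_i(q_i):=g_i(q_i/C_i)$, let $H_i$ be a function (unique up to a constant) with $H_i'=h_i$ (so $H_i''>0$), and set $H(q):=\sum_{i=1}^n H_i(q_i)$ (total electrical energy). Let $H_i^*(V_i)=\sup_{q_i\in\mathbb{R}}[q_iV_i-H_i(q_i)]$ be the Legendre-Fenchel transform, considered for $V_i$ in the image of $g_i$, and $H^*(V):=\sum_{i=1}^n H_i^*(V_i)$. The potential is $$P(V,I) := -\tfrac12 V^\top TV+\sum_{i=1}^n\frac{1}{R_iC_i}H_i^*(V_i)-V^\top I .$$ "The network is the gradient system in the coordinates $V$" means that $v(\cdot)$ is a solution of the Hopfield equations if and only if $V(\cdot)=(g_1(v_1(\cdot)),\dots,g_n(v_n(\cdot)))^\top$ is a solution of the displayed differential equation. *)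

theory Defs
  imports "HOL-Analysis.Analysis"
begin

section \<open>Gradients, Hessians, smoothness\<close>

definition grad :: "('a::real_inner \<Rightarrow> real) \<Rightarrow> 'a \<Rightarrow> 'a" where
  "grad f x = (THE D. GDERIV f x :> D)"

definition hessian :: "(real^'n \<Rightarrow> real) \<Rightarrow> real^'n \<Rightarrow> real^'n^'n" where
  "hessian f x = matrix (frechet_derivative (grad f) (at x))"

text \<open>On open sets this guarantees that \<^const>\<open>grad\<close> and \<^const>\<open>hessian\<close> are genuine derivatives.\<close>

definition twice_differentiable_on :: "(real^'n \<Rightarrow> real) \<Rightarrow> (real^'n) set \<Rightarrow> bool" where
  "twice_differentiable_on f U \<longleftrightarrow>
     (\<forall>x\<in>U. GDERIV f x :> grad f x) \<and> (\<forall>x\<in>U. grad f differentiable at x)"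

text \<open>Class $C^k$ on an open set: the gradient exists and its components, the partial
  derivatives, are of class $C^{k-1}$.\<close>

primrec Ck_on :: "nat \<Rightarrow> ('a::euclidean_space \<Rightarrow> real) \<Rightarrow> 'a set \<Rightarrow> bool" where
  "Ck_on 0 f U \<longleftrightarrow> continuous_on U f"
| "Ck_on (Suc k) f U \<longleftrightarrow>
     (\<exists>D. (\<forall>x\<in>U. GDERIV f x :> D x) \<and> (\<forall>b\<in>Basis. Ck_on k (\<lambda>x. D x \<bullet> b) U))"

definition smooth_on :: "('a::euclidean_space \<Rightarrow> real) \<Rightarrow> 'a set \<Rightarrow> bool" where
  "smooth_on f U \<longleftrightarrow> (\<forall>k. Ck_on k f U)"

lemma grad_eqI: "GDERIV f x :> D \<Longrightarrow> grad f x = D"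
  unfolding grad_def
proof (rule the_equality)
  fix E assume "GDERIV f x :> D" "GDERIV f x :> E"
  then have "(\<lambda>h. h \<bullet> E) = (\<lambda>h. h \<bullet> D)"
    unfolding gderiv_def by (rule has_derivative_unique[rotated])
  then show "E = D"
    by (metis inner_commute vector_eq_rdot)
qed

definition pos_def :: "real^'n^'n \<Rightarrow> bool" where
  "pos_def A \<longleftrightarrow> transpose A = A \<and> (\<forall>x. x \<noteq> 0 \<longrightarrow> x \<bullet> (A *v x) > 0)"

definition riemannian_metric_on :: "(real^'n) set \<Rightarrow> (real^'n \<Rightarrow> real^'n^'n) \<Rightarrow> bool" where
  "riemannian_metric_on U M \<longleftrightarrow>
     open U \<and> (\<forall>x\<in>U. pos_def (M x)) \<and> (\<forall>i j. smooth_on (\<lambda>x. M x $ i $ j) U)"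

section \<open>Legendre-Fenchel transform\<close>

definition legendre :: "(real \<Rightarrow> real) \<Rightarrow> real \<Rightarrow> real" where
  "legendre f V = (SUP q. q * V - f q)"

text \<open>The real-valued supremum is only meaningful if the set is bounded above. This is so for
  arguments in the image of the increasing derivative of \<open>f\<close>, where moreover it is attained.\<close>

lemma legendre_well_defined:
  fixes f h :: "real \<Rightarrow> real"
  assumes der: "\<And>q. (f has_real_derivative h q) (at q)" and "mono h" and V: "V \<in> range h"
  shows "bdd_above (range (\<lambda>q. q * V - f q))"
    and "\<exists>p. V = h p \<and> legendre f V = p * V - f p"
proof -
  obtain p where p: "V = h p" using V by blast
  have conv: "convex_on UNIV f"
    by (rule convex_on_realI[where f' = h]) (use der \<open>mono h\<close> in \<open>auto simp: mono_def\<close>)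
  have le: "q * V - f q \<le> p * V - f p" for q
  proof -
    have "f q - f p \<ge> h p * (q - p)"
      by (rule convex_on_imp_above_tangent[OF conv]) (use der in auto)
    then show ?thesis unfolding p by (simp add: algebra_simps)
  qed
  then show "bdd_above (range (\<lambda>q. q * V - f q))"
    by (auto intro!: bdd_aboveI)
  have "legendre f V = p * V - f p"
    unfolding legendre_def by (rule cSup_eq_maximum) (use le in auto)
  with p show "\<exists>p. V = h p \<and> legendre f V = p * V - f p" by blast
qed

section \<open>Hopfield networks\<close>

definition diag_mat :: "real^'n \<Rightarrow> real^'n^'n" where
  "diag_mat c = (\<chi> i j. if i = j then c $ i else 0)"

definition activation :: "('n \<Rightarrow> real \<Rightarrow> real) \<Rightarrow> real^'n \<Rightarrow> real^'n" where
  "activation g v = (\<chi> i. g i (v $ i))"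

definition image_box :: "('n \<Rightarrow> real \<Rightarrow> real) \<Rightarrow> (real^'n) set" where
  "image_box g = {V. \<forall>i. V $ i \<in> range (g i)}"

definition total_energy :: "('n::finite \<Rightarrow> real \<Rightarrow> real) \<Rightarrow> real^'n \<Rightarrow> real" where
  "total_energy H q = (\<Sum>i\<in>UNIV. H i (q $ i))"

definition total_coenergy :: "('n::finite \<Rightarrow> real \<Rightarrow> real) \<Rightarrow> real^'n \<Rightarrow> real" where
  "total_coenergy H V = (\<Sum>i\<in>UNIV. legendre (H i) (V $ i))"

definition potential ::
  "real^'n \<Rightarrow> real^'n \<Rightarrow> real^'n^'n \<Rightarrow> ('n::finite \<Rightarrow> real \<Rightarrow> real) \<Rightarrow> real^'n \<Rightarrow> real^'n \<Rightarrow> real" where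
  "potential C R T H V I =
     - (1/2) * (V \<bullet> (T *v V)) + (\<Sum>i\<in>UNIV. 1 / (R $ i * C $ i) * legendre (H i) (V $ i)) - V \<bullet> I"

text \<open>Solutions on a time interval \<open>J\<close>; derivatives at endpoints belonging to \<open>J\<close> are one-sided.
  No regularity of the input \<open>I\<close> is assumed.\<close>

definition hopfield_solution ::
  "real^'n \<Rightarrow> real^'n \<Rightarrow> real^'n^'n \<Rightarrow> ('n::finite \<Rightarrow> real \<Rightarrow> real) \<Rightarrow> (real \<Rightarrow> real^'n) \<Rightarrow> real set
    \<Rightarrow> (real \<Rightarrow> real^'n) \<Rightarrow> bool" where
  "hopfield_solution C R T g I J v \<longleftrightarrow>
     (\<forall>t\<in>J. \<exists>v'. (v has_vector_derivative v') (at t within J) \<and>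
        diag_mat C *v v' = T *v activation g (v t) - matrix_inv (diag_mat R) *v v t + I t)"

text \<open>The gradient system on \<open>U\<close> with metric \<open>M\<close> and potential \<open>P\<close> depending on an input \<open>I\<close>.\<close>

definition gradient_solution ::
  "(real^'n \<Rightarrow> real^'n^'n) \<Rightarrow> (real^'n \<Rightarrow> real^'n \<Rightarrow> real) \<Rightarrow> (real^'n) set \<Rightarrow> (real \<Rightarrow> real^'n) \<Rightarrow> real set
    \<Rightarrow> (real \<Rightarrow> real^'n) \<Rightarrow> bool" where
  "gradient_solution M P U I J V \<longleftrightarrow>
     (\<forall>t\<in>J. V t \<in> U \<and> (\<exists>V'. (V has_vector_derivative V') (at t within J) \<and>
        M (V t) *v V' = - grad (\<lambda>W. P W (I t)) (V t)))"

end

theory Submission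
  imports Defs
begin

text \<open>
  Energy and coenergy are separable, so the theorem comes down to one-variable calculus in each
  coordinate. Write $h_i(q) = g_i(q/C_i)$. Convexity of $H_i$ makes the supremum in $H_i^*(V_i)$
  attained at the $q_i$ with $h_i(q_i) = V_i$, and differentiating $q_i V_i - H_i(q_i)$ gives the
  envelope formula $(H_i^*)'(V_i) = q_i = C_i v_i$ (\<open>legendre_has_derivative\<close>). Thus
  $\partial H^*/\partial V$ is the inverse map of $\partial H/\partial q$, and the two Hessians,
  both diagonal by \<open>separable_twice_differentiable\<close>, are inverse to each other: the
  metric has the entries $C_i/g_i'(v_i)$. They are positive because $g_i' > 0$. They are smooth
  because $g_i^{-1}$ solves the autonomous equation $k' = 1/g_i'(k)$
  (\<open>smooth_on_compose_autonomous\<close>).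

  The envelope formula also gives
  $\partial P/\partial V = -TV + R^{-1}v - I$, the negative of the right-hand side of the network
  equation, because $\frac{1}{R_iC_i}\,C_iv_i = v_i/R_i$; here the symmetry of $T$ enters. Since
  $\dot V_i = g_i'(v_i)\,\dot v_i$, the metric turns $\dot V$ into $C\dot v$, and the network
  equation becomes the gradient system. Since $g_i^{-1}$ is
  differentiable, the same computation runs back from $V$ to $v$. The dissipation equality is then the chain rule, and the inequality is
  positivity of the metric.
\<close>

section \<open>Smooth functions of one real variable\<close>

lemma Ck_on_Suc_real:
  fixes f :: "real \<Rightarrow> real"
  shows "Ck_on (Suc n) f S \<longleftrightarrow>
    (\<exists>D. (\<forall>x\<in>S. (f has_real_derivative D x) (at x)) \<and> Ck_on n D S)"
  by simp

lemma Ck_on_SucI: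
  fixes f :: "real \<Rightarrow> real"
  assumes "Ck_on n D S" and "\<And>x. x \<in> S \<Longrightarrow> (f has_real_derivative D x) (at x)"
  shows "Ck_on (Suc n) f S"
  using assms unfolding Ck_on_Suc_real by blast

lemma Ck_on_const: "Ck_on n (\<lambda>_. c) S"
proof (induction n arbitrary: c)
  case (Suc n)
  show ?case
    by (auto intro!: exI[of _ "\<lambda>_. 0"] GDERIV_const Suc)
qed simp

text \<open>The Leibniz rule for $C^{n+1}$ functions needs the factors themselves, and not only their
  derivatives, to be of class $C^n$.\<close>

lemma Ck_on_SucD:
  fixes f :: "real \<Rightarrow> real"
  assumes "Ck_on (Suc n) f S"
  shows "Ck_on n f S"
  using assms
proof (induction n arbitrary: f)
  case 0
  then show ?case
    by (auto intro!: continuous_at_imp_continuous_on dest: DERIV_isCont)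
next
  case (Suc n)
  from Suc.prems obtain D where "\<forall>x\<in>S. (f has_real_derivative D x) (at x)" "Ck_on (Suc n) D S"
    unfolding Ck_on_Suc_real[of "Suc n"] by blast
  with Suc.IH[of D] show ?case
    by (intro Ck_on_SucI) auto
qed

lemma Ck_on_add:
  fixes f g :: "real \<Rightarrow> real"
  assumes "Ck_on n f S" "Ck_on n g S"
  shows "Ck_on n (\<lambda>x. f x + g x) S"
  using assms
proof (induction n arbitrary: f g)
  case 0
  then show ?case by (auto intro!: continuous_intros)
next
  case (Suc n)
  from Suc.prems obtain D E where
    "\<forall>x\<in>S. (f has_real_derivative D x) (at x)" "Ck_on n D S"
    "\<forall>x\<in>S. (g has_real_derivative E x) (at x)" "Ck_on n E S"
    unfolding Ck_on_Suc_real by blast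
  then show ?case
    by (intro Ck_on_SucI[where D = "\<lambda>x. D x + E x"] Suc.IH DERIV_add) auto
qed

lemma Ck_on_mult:
  fixes f g :: "real \<Rightarrow> real"
  assumes "Ck_on n f S" "Ck_on n g S"
  shows "Ck_on n (\<lambda>x. f x * g x) S"
  using assms
proof (induction n arbitrary: f g)
  case 0
  then show ?case by (auto intro!: continuous_intros)
next
  case (Suc n)
  from Suc.prems obtain D E where
    D: "\<forall>x\<in>S. (f has_real_derivative D x) (at x)" "Ck_on n D S" and
    E: "\<forall>x\<in>S. (g has_real_derivative E x) (at x)" "Ck_on n E S"
    unfolding Ck_on_Suc_real by blast
  have "Ck_on n (\<lambda>x. D x * g x + E x * f x) S"
    using D E Suc.prems[THEN Ck_on_SucD] by (intro Ck_on_add Suc.IH)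
  moreover have "((\<lambda>x. f x * g x) has_real_derivative D x * g x + E x * f x) (at x)" if "x \<in> S" for x
    using D(1) E(1) that by (blast intro: DERIV_mult)
  ultimately show ?case
    by (rule Ck_on_SucI)
qed

text \<open>The derivative $-f'/f^2$ is written with the factor $1/f$ itself, so that the induction
  hypothesis applies to it and only products remain.\<close>

lemma Ck_on_inverse:
  fixes f :: "real \<Rightarrow> real"
  assumes "Ck_on n f S" and nz: "\<And>x. x \<in> S \<Longrightarrow> f x \<noteq> 0"
  shows "Ck_on n (\<lambda>x. inverse (f x)) S"
  using assms(1)
proof (induction n)
  case 0
  then show ?case using nz by (auto intro!: continuous_intros)
next
  case (Suc n)
  from Suc.prems obtain D where
    D: "\<forall>x\<in>S. (f has_real_derivative D x) (at x)" "Ck_on n D S"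
    unfolding Ck_on_Suc_real by blast
  have inv: "Ck_on n (\<lambda>x. inverse (f x)) S"
    using Suc.prems[THEN Ck_on_SucD] by (rule Suc.IH)
  have "Ck_on n (\<lambda>x. - 1 * (inverse (f x) * D x * inverse (f x))) S"
    using D inv by (intro Ck_on_mult Ck_on_const)
  moreover have "((\<lambda>x. inverse (f x)) has_real_derivative - 1 * (inverse (f x) * D x * inverse (f x))) (at x)"
    if "x \<in> S" for x
    using DERIV_inverse'[of f "D x" x UNIV] D(1) nz that by simp
  ultimately show ?case
    by (rule Ck_on_SucI)
qed

lemma smooth_on_real_deriv:
  fixes f :: "real \<Rightarrow> real"
  assumes "smooth_on f UNIV"
  shows "(f has_real_derivative deriv f x) (at x)" and "smooth_on (deriv f) UNIV"
proof -
  have D: "\<exists>D. (\<forall>x. (f has_real_derivative D x) (at x)) \<and> Ck_on n D UNIV" for n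
    using assms unfolding smooth_on_def by (metis Ck_on_Suc_real UNIV_I)
  then show "(f has_real_derivative deriv f x) (at x)"
    by (metis DERIV_imp_deriv)
  have "Ck_on n (deriv f) UNIV" for n
  proof -
    obtain D where D: "\<forall>x. (f has_real_derivative D x) (at x)" "Ck_on n D UNIV"
      using D by blast
    then have "D = deriv f" by (metis DERIV_imp_deriv ext)
    with D show ?thesis by simp
  qed
  then show "smooth_on (deriv f) UNIV"
    by (simp add: smooth_on_def)
qed

text \<open>Solutions of an autonomous equation $k' = \phi(k)$ are smooth. Stated for $\psi \circ k$ with
  arbitrary smooth $\psi$, the claim reproduces itself under differentiation,
  $(\psi \circ k)' = (\psi'\phi) \circ k$; for $\psi = \mathrm{id}$ alone the induction would not
  close.\<close>

lemma smooth_on_compose_autonomous: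
  fixes k \<phi> \<psi> :: "real \<Rightarrow> real"
  assumes k: "\<And>y. y \<in> S \<Longrightarrow> (k has_real_derivative \<phi> (k y)) (at y)"
    and "smooth_on \<phi> UNIV" and "smooth_on \<psi> UNIV"
  shows "smooth_on (\<lambda>y. \<psi> (k y)) S"
  unfolding smooth_on_def
proof
  fix n
  show "Ck_on n (\<lambda>y. \<psi> (k y)) S"
    using assms(3)
  proof (induction n arbitrary: \<psi>)
    case 0
    then have \<psi>: "isCont \<psi> x" for x
      by (rule DERIV_isCont[OF smooth_on_real_deriv(1)])
    have "isCont (\<lambda>y. \<psi> (k y)) y" if "y \<in> S" for y
      by (rule isCont_o2[OF DERIV_isCont[OF k[OF that]] \<psi>])
    then show ?case
      by (simp add: continuous_at_imp_continuous_on)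
  next
    case (Suc n)
    have "smooth_on (\<lambda>x. deriv \<psi> x * \<phi> x) UNIV"
      using smooth_on_real_deriv(2)[OF Suc.prems] \<open>smooth_on \<phi> UNIV\<close>
      by (auto simp: smooth_on_def intro: Ck_on_mult)
    then have "Ck_on n (\<lambda>y. deriv \<psi> (k y) * \<phi> (k y)) S"
      by (rule Suc.IH)
    moreover have "((\<lambda>y. \<psi> (k y)) has_real_derivative deriv \<psi> (k y) * \<phi> (k y)) (at y)" if "y \<in> S" for y
      by (rule DERIV_chain2[OF smooth_on_real_deriv(1)[OF Suc.prems] k[OF that]])
    ultimately show ?case
      by (rule Ck_on_SucI)
  qed
qed

section \<open>Functions of one coordinate\<close>

lemma GDERIV_coordinate:
  fixes x :: "real^'n"
  assumes "(f has_real_derivative d) (at (x $ i))"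
  shows "GDERIV (\<lambda>y. f (y $ i)) x :> axis i d"
proof -
  have "((\<lambda>y. f (y $ i)) has_derivative (\<lambda>h. h $ i * d)) (at x)"
    using has_derivative_compose[OF bounded_linear_imp_has_derivative[OF bounded_linear_vec_nth]
        assms[unfolded has_field_derivative_def]] by (simp add: mult.commute)
  then show ?thesis
    by (simp add: gderiv_def inner_axis)
qed

lemma smooth_on_coordinate:
  fixes U :: "(real^'n) set"
  assumes "smooth_on f S" and "\<And>x. x \<in> U \<Longrightarrow> x $ i \<in> S"
  shows "smooth_on (\<lambda>x. f (x $ i)) U"
  unfolding smooth_on_def
proof
  fix n
  have "Ck_on n f S" using assms(1) by (simp add: smooth_on_def)
  then show "Ck_on n (\<lambda>x. f (x $ i)) U"
  proof (induction n arbitrary: f)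
    case 0
    then show ?case
      using assms(2) by (auto intro!: continuous_on_compose2[of S f] continuous_intros)
  next
    case (Suc n)
    from Suc.prems obtain D where
      D: "\<forall>x\<in>S. (f has_real_derivative D x) (at x)" "Ck_on n D S"
      unfolding Ck_on_Suc_real by blast
    have "Ck_on n (\<lambda>x. axis i (D (x $ i)) \<bullet> b) U" if b: "b \<in> Basis" for b :: "real^'n"
    proof -
      obtain j where "b = axis j 1" using b by (auto simp: Basis_vec_def)
      then show ?thesis
        using Suc.IH[OF D(2)] Ck_on_const[of n 0 U]
        by (cases "i = j") (simp_all add: inner_axis_axis)
    qed
    then show ?case
      using D(1) assms(2) by (auto intro!: exI[of _ "\<lambda>x. axis i (D (x $ i))"] GDERIV_coordinate)
  qed
qed

text \<open>Openness matters: the derivatives in the definition of $C^n$ are two-sided and see points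
  off the set.\<close>

lemma smooth_on_cong:
  assumes "smooth_on f U" "open U" and eq: "\<And>x. x \<in> U \<Longrightarrow> f x = g x"
  shows "smooth_on g U"
  unfolding smooth_on_def
proof
  fix n
  have "Ck_on n f U" using assms(1) by (simp add: smooth_on_def)
  then show "Ck_on n g U"
  proof (cases n)
    case 0
    then show ?thesis
      using \<open>Ck_on n f U\<close> eq by (auto cong: continuous_on_cong)
  next
    case (Suc m)
    have "GDERIV g x :> D" if "GDERIV f x :> D" "x \<in> U" for x D
      using that has_derivative_transform_within_open[OF _ \<open>open U\<close>] eq
      unfolding gderiv_def by blast
    moreover obtain D where D: "\<forall>x\<in>U. GDERIV f x :> D x" "\<forall>b\<in>Basis. Ck_on m (\<lambda>x. D x \<bullet> b) U"
      using \<open>Ck_on n f U\<close> unfolding Suc Ck_on.simps by blast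
    ultimately have "\<forall>x\<in>U. GDERIV g x :> D x" by blast
    with D(2) show ?thesis
      unfolding Suc Ck_on.simps by (intro exI[of _ D] conjI)
  qed
qed

section \<open>Increasing functions: inverse and Legendre transform\<close>

text \<open>The range is open by invariance of domain, so the derivative of the inverse is a genuine
  two-sided one; its value is the right-hand side $\phi(k) = 1/g'(k)$ of the autonomous equation
  for $k = g^{-1}$.\<close>

lemma strict_increasing_smooth_inverse:
  fixes g :: "real \<Rightarrow> real"
  assumes smooth: "smooth_on g UNIV" and pos: "\<And>x. deriv g x > 0"
  shows "inj g" and "open (range g)" and "strict_mono g"
    and "y \<in> range g \<Longrightarrow> (inv g has_real_derivative inverse (deriv g (inv g y))) (at y)"
proof -
  note g = smooth_on_real_deriv(1)[OF smooth]
  show "strict_mono g"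
  proof (rule strict_monoI)
    show "g a < g b" if "a < b" for a b
      by (rule DERIV_pos_imp_increasing[OF that]) (rule exI conjI g pos)+
  qed
  then show "inj g" by (rule strict_mono_imp_inj_on)
  have "continuous_on UNIV g"
    by (intro continuous_at_imp_continuous_on ballI DERIV_isCont[OF g])
  with \<open>inj g\<close> show "open (range g)"
    using invariance_of_domain[of UNIV g] by simp
  assume "y \<in> range g"
  then obtain x where x: "y = g x" by blast
  have "(inv g has_derivative (*) (inverse (deriv g x))) (at (g x))"
  proof (rule has_derivative_inverse_on[of UNIV g "\<lambda>x. (*) (deriv g x)"])
    show "(*) (deriv g x) \<circ> (*) (inverse (deriv g x)) = id"
      using pos[of x] by (simp add: fun_eq_iff)
    show "(g has_derivative (*) (deriv g z)) (at z)" for z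
      using g by (simp add: has_field_derivative_def)
  qed (use \<open>inj g\<close> in simp_all)
  then show "(inv g has_real_derivative inverse (deriv g (inv g y))) (at y)"
    unfolding x using \<open>inj g\<close> by (simp add: has_field_derivative_def)
qed

text \<open>The envelope formula. The supremum is attained at $p(V) = c\,g^{-1}(V)$, and in the
  derivative of $p(V)\,V - H(p(V))$ the two terms containing $p'$ cancel because
  $H'(p(V)) = V$.\<close>

lemma legendre_has_derivative:
  fixes g H :: "real \<Rightarrow> real"
  assumes smooth: "smooth_on g UNIV" and pos: "\<And>x. deriv g x > 0" and "c > 0"
    and H: "\<And>q. (H has_real_derivative g (q / c)) (at q)"
    and y: "y \<in> range g"
  shows "(legendre H has_real_derivative c * inv g y) (at y)"
proof -
  note inv = strict_increasing_smooth_inverse[OF smooth pos]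
  define p where "p = (\<lambda>V. c * inv g V)"
  have leg: "p V * V - H (p V) = legendre H V" if V: "V \<in> range g" for V
  proof -
    obtain x where "V = g x" using V by blast
    then have V': "V \<in> range (\<lambda>q. g (q / c))"
      using \<open>c > 0\<close> by (auto intro!: image_eqI[of _ _ "c * x"])
    have "mono (\<lambda>q. g (q / c))"
      using \<open>strict_mono g\<close> \<open>c > 0\<close>
      by (auto intro!: monoI simp: strict_mono_less_eq divide_right_mono)
    from legendre_well_defined(2)[OF H this V'] obtain r
      where r: "V = g (r / c)" "legendre H V = r * V - H r" by blast
    then have "p V = r"
      using \<open>inj g\<close> \<open>c > 0\<close> by (simp add: p_def)
    with r show ?thesis by simp
  qed
  define p' where "p' = c * inverse (deriv g (inv g y))"
  have p': "(p has_real_derivative p') (at y)"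
    unfolding p_def p'_def by (intro DERIV_cmult inv(4) y)
  have "g (p y / c) = y"
    using y \<open>c > 0\<close> by (simp add: p_def f_inv_into_f)
  then have "((\<lambda>V. H (p V)) has_real_derivative y * p') (at y)"
    using DERIV_chain2[OF H p'] by simp
  then have "((\<lambda>V. p V * V - H (p V)) has_real_derivative p y) (at y)"
    using p' by (auto intro!: derivative_eq_intros)
  then have "((\<lambda>V. legendre H V) has_real_derivative p y) (at y)"
    by (rule has_field_derivative_transform_within_open[OF _ inv(2) y leg])
  then show ?thesis by (simp add: p_def)
qed

section \<open>Separable functions\<close>

lemma diag_mat_vector_mult: "diag_mat c *v x = (\<chi> i. c $ i * x $ i)"
  by (simp add: vec_eq_iff diag_mat_def matrix_vector_mult_def if_distrib[of "\<lambda>a. a * _"] cong: if_cong)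

lemma diag_mat_inverse:
  fixes c :: "real^'n"
  assumes "\<And>i. c $ i \<noteq> 0"
  shows "invertible (diag_mat c)" and "matrix_inv (diag_mat c) = diag_mat (\<chi> i. inverse (c $ i))"
proof -
  let ?D = "diag_mat (\<chi> i. inverse (c $ i))"
  have "(diag_mat c ** ?D) *v x = mat 1 *v x" "(?D ** diag_mat c) *v x = mat 1 *v x" for x
    using assms
    by (simp_all add: matrix_vector_mul_assoc[symmetric] diag_mat_vector_mult vec_eq_iff)
  then have 1: "diag_mat c ** ?D = mat 1" "?D ** diag_mat c = mat 1"
    unfolding matrix_eq by auto
  then show inv: "invertible (diag_mat c)"
    unfolding invertible_def by blast
  have uniq: "B = ?D" if "diag_mat c ** B = mat 1 \<and> B ** diag_mat c = mat 1" for B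
    using that 1 by (metis matrix_mul_assoc matrix_mul_lid matrix_mul_rid)
  show "matrix_inv (diag_mat c) = ?D"
    unfolding matrix_inv_def by (rule some_equality) (rule conjI[OF 1], rule uniq)
qed

lemma pos_def_diag_mat:
  fixes c :: "real^'n"
  assumes "\<And>i. c $ i > 0"
  shows "pos_def (diag_mat c)"
  unfolding pos_def_def
proof (intro conjI allI impI)
  show "transpose (diag_mat c) = diag_mat c"
    by (simp add: vec_eq_iff transpose_def diag_mat_def)
  fix x :: "real^'n" assume "x \<noteq> 0"
  then obtain j where "x $ j \<noteq> 0" by (auto simp: vec_eq_iff)
  then have "(\<Sum>i\<in>UNIV. c $ i * (x $ i)\<^sup>2) > 0"
    using assms by (intro sum_pos2[of _ j]) (auto simp: less_imp_le)
  then show "x \<bullet> (diag_mat c *v x) > 0"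
    by (simp add: diag_mat_vector_mult inner_vec_def power2_eq_square algebra_simps)
qed

lemma coordinatewise_has_derivative:
  fixes x :: "real^'n"
  assumes "\<And>i. (d i has_real_derivative e i) (at (x $ i))"
  shows "((\<lambda>y. \<chi> i. d i (y $ i)) has_derivative (*v) (diag_mat (\<chi> i. e i))) (at x)"
proof (subst has_derivative_componentwise_within, intro ballI)
  fix b :: "real^'n" assume "b \<in> Basis"
  then obtain j where b: "b = axis j 1" by (auto simp: Basis_vec_def)
  show "((\<lambda>y. (\<chi> i. d i (y $ i)) \<bullet> b) has_derivative (\<lambda>y. (diag_mat (\<chi> i. e i) *v y) \<bullet> b)) (at x)"
    using GDERIV_coordinate[OF assms, of j]
    by (simp add: b inner_axis gderiv_def diag_mat_vector_mult mult.commute)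
qed

text \<open>Carries solution curves from $v$ to $V$, with $d_i = g_i$, and back, with
  $d_i = g_i^{-1}$.\<close>

lemma coordinatewise_has_vector_derivative:
  fixes x :: "real \<Rightarrow> real^'n"
  assumes "(x has_vector_derivative x') (at t within J)"
    and "\<And>i. (d i has_real_derivative e i) (at (x t $ i))"
  shows "((\<lambda>s. \<chi> i. d i (x s $ i)) has_vector_derivative (\<chi> i. e i * x' $ i)) (at t within J)"
proof -
  have "((\<lambda>y. \<chi> i. d i (y $ i)) has_derivative (*v) (diag_mat (\<chi> i. e i))) (at (x t) within x ` J)"
    by (rule has_derivative_at_withinI[OF coordinatewise_has_derivative]) (rule assms(2))
  from vector_derivative_diff_chain_within[OF assms(1) this] show ?thesis
    by (simp add: o_def diag_mat_vector_mult)
qed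

lemma GDERIV_separable:
  fixes x :: "real^'n"
  assumes "\<And>i. (f i has_real_derivative d i) (at (x $ i))"
  shows "GDERIV (\<lambda>y. \<Sum>i\<in>UNIV. f i (y $ i)) x :> (\<chi> i. d i)"
proof -
  have "((\<lambda>y. \<Sum>i\<in>UNIV. f i (y $ i)) has_derivative (\<lambda>h. \<Sum>i\<in>UNIV. h \<bullet> axis i (d i))) (at x)"
    using GDERIV_coordinate[OF assms] by (intro has_derivative_sum) (simp add: gderiv_def)
  then show ?thesis
    by (simp add: gderiv_def inner_axis) (simp add: inner_vec_def)
qed

text \<open>Openness of the box makes the gradient agree with $(d_i(x_i))_i$ near each point, so that
  the Hessian may be computed from this formula.\<close>

lemma separable_twice_differentiable:
  fixes S :: "'n::finite \<Rightarrow> real set"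
  defines "U \<equiv> {x :: real^'n. \<forall>i. x $ i \<in> S i}"
  assumes "\<And>i. open (S i)"
    and f: "\<And>i y. y \<in> S i \<Longrightarrow> (f i has_real_derivative d i y) (at y)"
    and d: "\<And>i y. y \<in> S i \<Longrightarrow> (d i has_real_derivative e i y) (at y)"
  defines "F \<equiv> \<lambda>x :: real^'n. \<Sum>i\<in>UNIV. f i (x $ i)"
  shows "open U" and "twice_differentiable_on F U"
    and "x \<in> U \<Longrightarrow> grad F x = (\<chi> i. d i (x $ i))"
    and "x \<in> U \<Longrightarrow> hessian F x = diag_mat (\<chi> i. e i (x $ i))"
proof -
  have "U = (\<Inter>i. (\<lambda>x. x $ i) -` S i)"
    by (auto simp: U_def)
  then show "open U"
    using assms(2) by (auto intro!: open_INT open_vimage continuous_intros)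
  have G: "GDERIV F x :> (\<chi> i. d i (x $ i))" if "x \<in> U" for x
    unfolding F_def by (rule GDERIV_separable) (use that f in \<open>auto simp: U_def\<close>)
  then have grad: "grad F x = (\<chi> i. d i (x $ i))" if "x \<in> U" for x
    using that grad_eqI by blast
  then show "x \<in> U \<Longrightarrow> grad F x = (\<chi> i. d i (x $ i))" .
  have D: "(grad F has_derivative (*v) (diag_mat (\<chi> i. e i (x $ i)))) (at x)" if "x \<in> U" for x
  proof (rule has_derivative_transform_within_open[OF _ \<open>open U\<close> that])
    show "((\<lambda>y. \<chi> i. d i (y $ i)) has_derivative (*v) (diag_mat (\<chi> i. e i (x $ i)))) (at x)"
      by (rule coordinatewise_has_derivative) (use that d in \<open>auto simp: U_def\<close>)
  qed (simp add: grad)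
  show "twice_differentiable_on F U"
    unfolding twice_differentiable_on_def differentiable_def using G grad D by auto
  show "hessian F x = diag_mat (\<chi> i. e i (x $ i))" if "x \<in> U"
    unfolding hessian_def frechet_derivative_at[OF D[OF that], symmetric] by simp
qed

section \<open>The network as a gradient system\<close>

text \<open>Symmetry of $T$ is what makes the gradient of the quadratic part equal to $-TV$ instead of
  $-\frac12(T + T^\top)V$.\<close>

lemma GDERIV_potential:
  fixes C R a V d :: "real^'n::finite"
  assumes "transpose T = T"
    and "\<And>i. (legendre (H i) has_real_derivative d $ i) (at (V $ i))"
  shows "GDERIV (\<lambda>W. potential C R T H W a) V :> - (T *v V) + (\<chi> i. d $ i / (R $ i * C $ i)) - a"
proof -
  let ?L = "\<lambda>W :: real^'n. \<Sum>i\<in>UNIV. 1 / (R $ i * C $ i) * legendre (H i) (W $ i)"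
  have "GDERIV ?L V :> (\<chi> i. 1 / (R $ i * C $ i) * d $ i)"
    by (rule GDERIV_separable) (intro DERIV_cmult assms(2))
  then have L: "(?L has_derivative (\<lambda>h. h \<bullet> (\<chi> i. d $ i / (R $ i * C $ i)))) (at V)"
    by (simp add: gderiv_def)
  have sym: "V \<bullet> (T *v h) = h \<bullet> (T *v V)" for h
    using dot_lmul_matrix[of V T h] assms(1)
    by (metis inner_commute transpose_matrix_vector)
  have T: "((\<lambda>W. T *v W) has_derivative (\<lambda>h. T *v h)) (at V)"
    by (simp add: bounded_linear_imp_has_derivative)
  show ?thesis
    unfolding gderiv_def potential_def
    by (rule has_derivative_eq_rhs, (rule derivative_intros L T)+)
      (auto simp: sym inner_simps fun_eq_iff)
qed

theorem mainTheorem2: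
  fixes C R :: "real^'n" and T :: "real^'n^'n"
    and g H :: "'n::finite \<Rightarrow> real \<Rightarrow> real"
  assumes "\<And>i. C $ i > 0" and "\<And>i. R $ i > 0"
    and "transpose T = T"
    and "\<And>i. smooth_on (g i) UNIV" and "\<And>i. bounded (range (g i))"
    and "\<And>i x. deriv (g i) x > 0"
    and "\<And>i q. (H i has_real_derivative g i (q / C $ i)) (at q)"
  defines "U \<equiv> image_box g"
    and "M \<equiv> hessian (total_coenergy H)"
    and "P \<equiv> potential C R T H"
  shows
    \<comment> \<open>\<open>V\<close> is a coordinate with values in \<open>U\<close>\<close>
    "bij_betw (activation g) UNIV U \<and>
    \<comment> \<open>the derivatives occurring below exist\<close>
    twice_differentiable_on (total_coenergy H) U \<and>
    twice_differentiable_on (total_energy H) UNIV \<and>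
    (\<forall>V\<in>U. \<forall>a. GDERIV (\<lambda>W. P W a) V :> grad (\<lambda>W. P W a) V) \<and>
    \<comment> \<open>the metric\<close>
    riemannian_metric_on U M \<and>
    (\<forall>v V q. V = activation g v \<and> q = diag_mat C *v v \<longrightarrow>
       V = grad (total_energy H) q \<and>
       invertible (hessian (total_energy H) q) \<and>
       M V = matrix_inv (hessian (total_energy H) q)) \<and>
    \<comment> \<open>the network is the gradient system\<close>
    (\<forall>I J v. is_interval J \<and> interior J \<noteq> {} \<longrightarrow>
       (hopfield_solution C R T g I J v \<longleftrightarrow>
        gradient_solution M P U I J (\<lambda>t. activation g (v t)))) \<and>
    (\<forall>V\<in>U. \<forall>a. GDERIV (P V) a :> - V) \<and>
    \<comment> \<open>the dissipation inequality\<close>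
    (\<forall>I I' J v V. is_interval J \<and> interior J \<noteq> {} \<and>
       (\<forall>t\<in>J. (I has_vector_derivative I' t) (at t within J)) \<and>
       hopfield_solution C R T g I J v \<and> V = (\<lambda>t. activation g (v t)) \<longrightarrow>
       (\<forall>t\<in>J. \<exists>V'. (V has_vector_derivative V') (at t within J) \<and>
          ((\<lambda>s. P (V s) (I s)) has_real_derivative
             (- (V' \<bullet> (M (V t) *v V')) - V t \<bullet> I' t)) (at t within J) \<and>
          - (V' \<bullet> (M (V t) *v V')) - V t \<bullet> I' t \<le> - (V t \<bullet> I' t)))"
proof -
  note C = assms(1) and R = assms(2)
  note inv = strict_increasing_smooth_inverse[OF assms(4) assms(6)]
  note deriv_g = smooth_on_real_deriv(1)[OF assms(4)]
  have inv_g: "inv (g i) (g i x) = x" for i x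
    using inv(1) by simp
  have U_eq: "U = {V. \<forall>i. V $ i \<in> range (g i)}"
    by (simp add: U_def image_box_def)
  have act_nth [simp]: "activation g v $ i = g i (v $ i)" for v i
    by (simp add: activation_def)
  have act_U: "activation g v \<in> U" for v
    by (simp add: U_eq)
  have U_act: "\<exists>v. V = activation g v" if "V \<in> U" for V
    using that by (intro exI[of _ "\<chi> i. inv (g i) (V $ i)"]) (simp add: vec_eq_iff U_eq f_inv_into_f)
  have bij: "bij_betw (activation g) UNIV U"
    unfolding bij_betw_def
  proof
    show "inj (activation g)"
      by (rule injI) (metis act_nth inv_g vec_eq_iff)
    show "range (activation g) = U"
      using act_U U_act by blast
  qed

  \<comment> \<open>the diagonal entries of the metric as functions of $V_i$\<close>
  define m where "m = (\<lambda>i y. C $ i * inverse (deriv (g i) (inv (g i) y)))"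
  have leg: "(legendre (H i) has_real_derivative C $ i * inv (g i) y) (at y)" if "y \<in> range (g i)" for i y
    by (rule legendre_has_derivative[OF assms(4,6,1,7) that])
  have leg2: "((\<lambda>y. C $ i * inv (g i) y) has_real_derivative m i y) (at y)" if "y \<in> range (g i)" for i y
    unfolding m_def by (intro DERIV_cmult inv(4) that)
  have coenergy: "total_coenergy H = (\<lambda>V. \<Sum>i\<in>UNIV. legendre (H i) (V $ i))"
    by (simp add: fun_eq_iff total_coenergy_def)
  have sep: "open U" "twice_differentiable_on (total_coenergy H) U"
    "\<And>V. V \<in> U \<Longrightarrow> hessian (total_coenergy H) V = diag_mat (\<chi> i. m i (V $ i))"
    unfolding U_eq coenergy
    by (rule separable_twice_differentiable[where S = "\<lambda>i. range (g i)" and e = m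
          and d = "\<lambda>i y. C $ i * inv (g i) y"];
          (rule inv(2) leg leg2)?; assumption?)+
  have M: "M V = diag_mat (\<chi> i. m i (V $ i))" if "V \<in> U" for V
    unfolding M_def by (rule sep(3)[OF that])
  have M_act: "M (activation g v) = diag_mat (\<chi> i. C $ i * inverse (deriv (g i) (v $ i)))" for v
    by (simp add: M act_U m_def inv_g)

  have energy1: "(H i has_real_derivative g i (q / C $ i)) (at q)" for i q
    by (rule assms(7))
  have energy2: "((\<lambda>q. g i (q / C $ i)) has_real_derivative deriv (g i) (q / C $ i) * (1 / C $ i)) (at q)" for i q
    by (rule DERIV_chain2[OF deriv_g DERIV_cdivide[OF DERIV_ident]])
  have energy: "total_energy H = (\<lambda>q. \<Sum>i\<in>UNIV. H i (q $ i))"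
    by (simp add: fun_eq_iff total_energy_def)
  have UNIV_eq: "UNIV = {x :: real^'n. \<forall>i. x $ i \<in> UNIV}"
    by simp
  note sepE = separable_twice_differentiable[where S = "\<lambda>_. UNIV" and f = H,
      OF open_UNIV energy1 energy2, folded UNIV_eq energy]

  have metric_pos: "pos_def (M V)" if "V \<in> U" for V
    unfolding M[OF that] using C assms(6) by (intro pos_def_diag_mat) (simp add: m_def)
  have metric: "riemannian_metric_on U M"
    unfolding riemannian_metric_on_def
  proof (intro conjI ballI allI)
    show "open U" by (rule sep(1))
    show "pos_def (M V)" if "V \<in> U" for V using that by (rule metric_pos)
    fix i j
    have "smooth_on (\<lambda>V. if i = j then m i (V $ i) else 0) U"
    proof (cases "i = j")
      case True
      have \<phi>: "smooth_on (\<lambda>x. inverse (deriv (g i) x)) UNIV"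
        using smooth_on_real_deriv(2)[OF assms(4)] assms(6)[THEN less_imp_neq]
        unfolding smooth_on_def by (metis Ck_on_inverse)
      then have \<psi>: "smooth_on (\<lambda>x. C $ i * inverse (deriv (g i) x)) UNIV"
        unfolding smooth_on_def by (intro allI Ck_on_mult Ck_on_const) simp
      have "smooth_on (m i) (range (g i))"
        unfolding m_def by (rule smooth_on_compose_autonomous[OF inv(4) \<phi> \<psi>])
      then have "smooth_on (\<lambda>V. m i (V $ i)) U"
        by (rule smooth_on_coordinate) (simp add: U_eq)
      with True show ?thesis by simp
    next
      case False
      then show ?thesis by (simp add: smooth_on_def Ck_on_const)
    qed
    then show "smooth_on (\<lambda>V. M V $ i $ j) U"
      by (rule smooth_on_cong) (auto simp: sep(1) M diag_mat_def)
  qed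

  have duality: "V = grad (total_energy H) q \<and> invertible (hessian (total_energy H) q) \<and>
      M V = matrix_inv (hessian (total_energy H) q)"
    if "V = activation g v" "q = diag_mat C *v v" for v V q
  proof -
    have q: "q $ i / C $ i = v $ i" for i
      using that C[of i] by (simp add: diag_mat_vector_mult)
    have nz: "deriv (g i) x \<noteq> 0" "C $ i \<noteq> 0" for i x
      using assms(6)[of i x] C[of i] by auto
    have hess: "hessian (total_energy H) q = diag_mat (\<chi> i. deriv (g i) (v $ i) / C $ i)"
      using sepE(4)[of q] by (simp add: q)
    have "V = grad (total_energy H) q"
      using sepE(3)[of q] by (simp add: q that(1) vec_eq_iff)
    moreover have "M V = diag_mat (\<chi> i. inverse (deriv (g i) (v $ i) / C $ i))"
      by (simp add: that(1) M_act divide_inverse mult.commute)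
    ultimately show ?thesis
      unfolding hess using nz by (simp add: diag_mat_inverse)
  qed

  have gradP: "GDERIV (\<lambda>W. P W a) (activation g v) :> - (T *v activation g v) + (\<chi> i. v $ i / R $ i) - a" for v a
  proof -
    have "(legendre (H i) has_real_derivative (\<chi> i. C $ i * v $ i) $ i) (at (activation g v $ i))" for i
      using leg[of "g i (v $ i)" i] by (simp add: inv_g)
    from GDERIV_potential[OF assms(3) this, of C R a]
    show ?thesis
      using C[THEN less_imp_neq] by (simp add: P_def)
  qed
  have R_inv: "matrix_inv (diag_mat R) *v v = (\<chi> i. v $ i / R $ i)" for v
    using R[THEN less_imp_neq]
    by (simp add: diag_mat_inverse diag_mat_vector_mult divide_inverse mult.commute)

  have equiv: "hopfield_solution C R T g I J v \<longleftrightarrow> gradient_solution M P U I J (\<lambda>t. activation g (v t))" for I J v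
  proof -
    have rhs: "T *v activation g (v t) - matrix_inv (diag_mat R) *v v t + I t
        = - grad (\<lambda>W. P W (I t)) (activation g (v t))" for t
      by (simp add: grad_eqI[OF gradP] R_inv)
    \<comment> \<open>The metric turns the velocity of \<open>V\<close> into \<open>C\<close> times the velocity of \<open>v\<close>, both ways.\<close>
    have fwd: "\<exists>V'. ((\<lambda>t. activation g (v t)) has_vector_derivative V') (at t within J) \<and>
        M (activation g (v t)) *v V' = diag_mat C *v v'"
      if v': "(v has_vector_derivative v') (at t within J)" for t v'
    proof (intro exI conjI)
      show "((\<lambda>t. activation g (v t)) has_vector_derivative
          (\<chi> i. deriv (g i) (v t $ i) * v' $ i)) (at t within J)"
        unfolding activation_def by (rule coordinatewise_has_vector_derivative[OF v' deriv_g])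
      show "M (activation g (v t)) *v (\<chi> i. deriv (g i) (v t $ i) * v' $ i) = diag_mat C *v v'"
        using assms(6)[THEN less_imp_neq]
        by (simp add: M_act diag_mat_vector_mult vec_eq_iff)
    qed
    have bwd: "\<exists>v'. (v has_vector_derivative v') (at t within J) \<and>
        diag_mat C *v v' = M (activation g (v t)) *v V'"
      if V': "((\<lambda>t. activation g (v t)) has_vector_derivative V') (at t within J)" for t V'
    proof (intro exI conjI)
      let ?v' = "\<chi> i. inverse (deriv (g i) (v t $ i)) * V' $ i"
      have "(inv (g i) has_real_derivative inverse (deriv (g i) (v t $ i))) (at (activation g (v t) $ i))" for i
        using inv(4)[of "g i (v t $ i)" i] by (simp add: inv_g)
      from coordinatewise_has_vector_derivative[where d = "\<lambda>i. inv (g i)", OF V' this]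
      show "(v has_vector_derivative ?v') (at t within J)"
        by (simp add: inv_g)
      show "diag_mat C *v ?v' = M (activation g (v t)) *v V'"
        by (simp add: M_act diag_mat_vector_mult vec_eq_iff)
    qed
    show ?thesis
      unfolding hopfield_solution_def gradient_solution_def rhs
      using fwd bwd act_U by (metis (no_types, lifting))
  qed

  have out: "GDERIV (P V) a :> - V" for V a
    unfolding gderiv_def P_def potential_def
    by (rule has_derivative_eq_rhs, (rule derivative_intros)+) (simp add: inner_commute)

  have dissipation: "\<exists>V'. (V has_vector_derivative V') (at t within J) \<and>
      ((\<lambda>s. P (V s) (I s)) has_real_derivative
         (- (V' \<bullet> (M (V t) *v V')) - V t \<bullet> I' t)) (at t within J) \<and>
      - (V' \<bullet> (M (V t) *v V')) - V t \<bullet> I' t \<le> - (V t \<bullet> I' t)"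
    if I': "(I has_vector_derivative I' t) (at t within J)" and t: "t \<in> J"
      and sol: "hopfield_solution C R T g I J v" and V: "V = (\<lambda>t. activation g (v t))"
    for I I' J v V t
  proof -
    from sol t obtain V' where V': "(V has_vector_derivative V') (at t within J)"
      and flow: "M (V t) *v V' = - grad (\<lambda>W. P W (I t)) (V t)"
      unfolding equiv gradient_solution_def V by blast
    \<comment> \<open>\<open>E\<close> is the gradient at zero input. Splitting off the term \<open>V \<bullet> I\<close>, the only one that
      contains the input, leaves a function of \<open>V\<close> alone for the chain rule.\<close>
    define E where "E = - (T *v V t) + (\<chi> i. v t $ i / R $ i)"
    have G: "GDERIV (\<lambda>W. P W a) (V t) :> E - a" for a
      using gradP[of a "v t"] by (simp add: V E_def)
    have flow': "M (V t) *v V' = I t - E"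
      by (simp add: flow grad_eqI[OF G])
    have "((\<lambda>W. P W 0) has_derivative (\<lambda>h. h \<bullet> E)) (at (V t) within V ` J)"
      using G[of 0] by (simp add: gderiv_def has_derivative_at_withinI)
    from vector_derivative_diff_chain_within[OF V' this]
    have "((\<lambda>s. P (V s) 0) has_vector_derivative V' \<bullet> E) (at t within J)"
      by (simp add: o_def)
    from has_vector_derivative_diff[OF this
        bounded_bilinear.has_vector_derivative[OF bounded_bilinear_inner V' I']]
    have "((\<lambda>s. P (V s) 0 - V s \<bullet> I s) has_vector_derivative
        V' \<bullet> E - (V t \<bullet> I' t + V' \<bullet> I t)) (at t within J)" .
    moreover have "P W 0 - W \<bullet> a = P W a" for W a
      by (simp add: P_def potential_def)
    ultimately have "((\<lambda>s. P (V s) (I s)) has_real_derivative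
        - (V' \<bullet> (M (V t) *v V')) - V t \<bullet> I' t) (at t within J)"
      by (simp add: has_real_derivative_iff_has_vector_derivative flow' inner_diff_right algebra_simps)
    moreover have "V' \<bullet> (M (V t) *v V') \<ge> 0"
      using metric_pos[OF act_U[of "v t"]] unfolding pos_def_def V
      by (cases "V' = 0") (auto simp: less_imp_le)
    ultimately show ?thesis
      using V' by (intro exI[of _ V']) simp
  qed

  have gradP': "GDERIV (\<lambda>W. P W a) V :> grad (\<lambda>W. P W a) V" if "V \<in> U" for V a
    using U_act[OF that] gradP grad_eqI by metis

  show ?thesis
  proof (intro conjI bij sep(2) sepE(2) metric)
    show "\<forall>V\<in>U. \<forall>a. GDERIV (\<lambda>W. P W a) V :> grad (\<lambda>W. P W a) V"
      using gradP' by blast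
    show "\<forall>v V q. V = activation g v \<and> q = diag_mat C *v v \<longrightarrow>
       V = grad (total_energy H) q \<and>
       invertible (hessian (total_energy H) q) \<and>
       M V = matrix_inv (hessian (total_energy H) q)"
      using duality by blast
    show "\<forall>I J v. is_interval J \<and> interior J \<noteq> {} \<longrightarrow>
       (hopfield_solution C R T g I J v \<longleftrightarrow>
        gradient_solution M P U I J (\<lambda>t. activation g (v t)))"
      by (simp add: equiv)
    show "\<forall>V\<in>U. \<forall>a. GDERIV (P V) a :> - V"
      using out by blast
  qed (intro allI impI ballI, elim conjE, rule dissipation, erule (1) bspec, assumption+)
qed

end
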